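(* Let $d\ge n$, let $H$ be a subgroup of $GL_n$, and let $Z$ be an affine variety on which $H$ acts regularly. Then ${}^Hk[M_{n,d}\times Z]$ is integral over its subalgebra $GL_d * j({}^Hk[M_{n,n}\times Z])$. In particular, ${}^Hk[M_{n,d}]$ is integral over $GL_d * j({}^Hk[M_{n,n}])$.
   Context: $k$ is an algebraically closed field of characteristic $p\ge 0$; $GL_m=GL_m(k)$; $M_{n,d}$ is the space of $n\times d$ matrices over $k$, with $d\ge n$, and $x=(x_1,\dots,x_d)\in M_{n,d}$ has $i$th column $x_i$. The action of $H$ on $Z$ is written $(h,z)\mapsto hz$. $H$ acts on $M_{n,d}\times Z$ by $h(x;z)=(hx;hz)$, hence on $k[M_{n,d}\times Z]$ by $(hF)(x;z)=F(h^{-1}x;h^{-1}z)$, and ${}^Hk[M_{n,d}\times Z]$ is the algebra of $H$-fixed functions. $GL_d$ acts on $k[M_{n,d}\times Z]$ by $(g*F)(x;z)=F(xg;z)$; this commutes with the action of $H$. The map $j:k[M_{n,n}\times Z]\to k[M_{n,d}\times Z]$ is $(jF)(x_1,\dots,x_d;z)=F(x_1,\dots,x_n;z)$. $GL_d*j({}^Hk[M_{n,n}\times Z])$ is the $k$-algebra generated by all $g*jf$ with $g\in GL_d$, $f\in {}^Hk[M_{n,n}\times Z]$. Taking $Z=\{0\}$ gives ${}^Hk[M_{n,d}]$ and $GL_d*j({}^Hk[M_{n,n}])$. *)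

theory Defs
  imports
    "Jordan_Normal_Form.Matrix"
    "HOL-Algebra.Group_Action"
    "HOL-Computational_Algebra.Polynomial"
begin

text \<open>
  A \<open>k\<close>-valued function on a set \<open>X\<close> is an element of \<open>X \<rightarrow>\<^sub>E UNIV\<close>, i.e. it is
  \<open>undefined\<close> outside \<open>X\<close>; so equality of such functions is equality on \<open>X\<close>.
  All algebras below are \<open>k\<close>-algebras of functions on a set, with pointwise operations.
\<close>

inductive_set generated_algebra :: "'x set \<Rightarrow> ('x \<Rightarrow> 'k :: field) set \<Rightarrow> ('x \<Rightarrow> 'k) set"
  for X :: "'x set" and G :: "('x \<Rightarrow> 'k) set"
  where
    generator: "f \<in> G \<Longrightarrow> restrict f X \<in> generated_algebra X G"
  | const: "(\<lambda>x\<in>X. c) \<in> generated_algebra X G"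
  | add: "f \<in> generated_algebra X G \<Longrightarrow> g \<in> generated_algebra X G \<Longrightarrow>
      (\<lambda>x\<in>X. f x + g x) \<in> generated_algebra X G"
  | mult: "f \<in> generated_algebra X G \<Longrightarrow> g \<in> generated_algebra X G \<Longrightarrow>
      (\<lambda>x\<in>X. f x * g x) \<in> generated_algebra X G"

definition integral_element :: "'x set \<Rightarrow> ('x \<Rightarrow> 'k :: field) set \<Rightarrow> ('x \<Rightarrow> 'k) \<Rightarrow> bool" where
  "integral_element X A f \<longleftrightarrow>
     (\<exists>m>0. \<exists>c :: nat \<Rightarrow> 'x \<Rightarrow> 'k. (\<forall>i<m. c i \<in> A) \<and>
        (\<forall>x\<in>X. f x ^ m + (\<Sum>i<m. c i x * f x ^ i) = 0))"

definition integral_over :: "'x set \<Rightarrow> ('x \<Rightarrow> 'k :: field) set \<Rightarrow> ('x \<Rightarrow> 'k) set \<Rightarrow> bool" where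
  "integral_over X B A \<longleftrightarrow> A \<subseteq> B \<and> (\<forall>f\<in>B. integral_element X A f)"

text \<open>Affine varieties are Zariski closed subsets of some \<open>k\<^sup>m\<close>; they need not be irreducible.\<close>

definition coordinate_ring :: "nat \<Rightarrow> 'k :: field vec set \<Rightarrow> ('k vec \<Rightarrow> 'k) set" where
  "coordinate_ring m Z = generated_algebra Z {\<lambda>z. z $ l | l. l < m}"

definition affine_variety :: "nat \<Rightarrow> 'k :: field vec set \<Rightarrow> bool" where
  "affine_variety m Z \<longleftrightarrow>
     (\<exists>S \<subseteq> coordinate_ring m (carrier_vec m). Z = {z \<in> carrier_vec m. \<forall>f\<in>S. f z = 0})"

definition regular_map :: "nat \<Rightarrow> 'k :: field vec set \<Rightarrow> ('k vec \<Rightarrow> 'k vec) \<Rightarrow> bool" where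
  "regular_map m Z \<phi> \<longleftrightarrow> \<phi> \<in> Z \<rightarrow> Z \<and> (\<forall>l<m. (\<lambda>z\<in>Z. \<phi> z $ l) \<in> coordinate_ring m Z)"

abbreviation GL :: "nat \<Rightarrow> 'k :: field mat monoid" where
  "GL n \<equiv> units_of (ring_mat TYPE('k) n ())"

text \<open>
  \<open>H\<close> is an abstract, not necessarily closed, subgroup of \<open>GL n\<close>, so there is in general
  no variety structure on \<open>H\<close>; \<open>H\<close> acts regularly if each of its elements acts by a
  regular map.  This holds in particular if the action is algebraic jointly in \<open>(h, z)\<close>.
\<close>

definition acts_regularly ::
  "nat \<Rightarrow> 'k :: field mat set \<Rightarrow> nat \<Rightarrow> 'k vec set \<Rightarrow> ('k mat \<Rightarrow> 'k vec \<Rightarrow> 'k vec) \<Rightarrow> bool" where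
  "acts_regularly n H m Z act \<longleftrightarrow>
     group_action (GL n\<lparr>carrier := H\<rparr>) Z act \<and> (\<forall>h\<in>H. regular_map m Z (act h))"

text \<open>The algebra \<open>k[M\<^bsub>n,d\<^esub> \<times> Z]\<close>.\<close>

definition matrix_coordinate_ring ::
  "nat \<Rightarrow> nat \<Rightarrow> nat \<Rightarrow> 'k :: field vec set \<Rightarrow> ('k mat \<times> 'k vec \<Rightarrow> 'k) set" where
  "matrix_coordinate_ring n d m Z = generated_algebra (carrier_mat n d \<times> Z)
     ({\<lambda>(x, z). x $$ (i, j) | i j. i < n \<and> j < d} \<union> {\<lambda>(x, z). z $ l | l. l < m})"

definition H_act ::
  "nat \<Rightarrow> nat \<Rightarrow> 'k :: field vec set \<Rightarrow> ('k mat \<Rightarrow> 'k vec \<Rightarrow> 'k vec) \<Rightarrow>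
   'k mat \<Rightarrow> ('k mat \<times> 'k vec \<Rightarrow> 'k) \<Rightarrow> ('k mat \<times> 'k vec \<Rightarrow> 'k)" where
  "H_act n d Z act h F =
     (\<lambda>(x, z)\<in>carrier_mat n d \<times> Z. F (inv\<^bsub>GL n\<^esub> h * x, act (inv\<^bsub>GL n\<^esub> h) z))"

definition H_invariants ::
  "nat \<Rightarrow> nat \<Rightarrow> 'k :: field mat set \<Rightarrow> nat \<Rightarrow> 'k vec set \<Rightarrow> ('k mat \<Rightarrow> 'k vec \<Rightarrow> 'k vec) \<Rightarrow>
   ('k mat \<times> 'k vec \<Rightarrow> 'k) set" where
  "H_invariants n d H m Z act =
     {F \<in> matrix_coordinate_ring n d m Z. \<forall>h\<in>H. H_act n d Z act h F = F}"

definition GL_act ::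
  "nat \<Rightarrow> nat \<Rightarrow> 'k :: field vec set \<Rightarrow> 'k mat \<Rightarrow>
   ('k mat \<times> 'k vec \<Rightarrow> 'k) \<Rightarrow> ('k mat \<times> 'k vec \<Rightarrow> 'k)" where
  "GL_act n d Z g F = (\<lambda>(x, z)\<in>carrier_mat n d \<times> Z. F (x * g, z))"

definition j_map ::
  "nat \<Rightarrow> nat \<Rightarrow> 'k :: field vec set \<Rightarrow> ('k mat \<times> 'k vec \<Rightarrow> 'k) \<Rightarrow> ('k mat \<times> 'k vec \<Rightarrow> 'k)" where
  "j_map n d Z F =
     (\<lambda>(x, z)\<in>carrier_mat n d \<times> Z. F (mat n n (\<lambda>(i, l). x $$ (i, l)), z))"

text \<open>The algebra \<open>GL\<^sub>d * j(A)\<close>, for a set \<open>A\<close> of functions on \<open>M\<^bsub>n,n\<^esub> \<times> Z\<close>.\<close>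

definition GL_j_algebra ::
  "nat \<Rightarrow> nat \<Rightarrow> 'k :: field vec set \<Rightarrow> ('k mat \<times> 'k vec \<Rightarrow> 'k) set \<Rightarrow>
   ('k mat \<times> 'k vec \<Rightarrow> 'k) set" where
  "GL_j_algebra n d Z A = generated_algebra (carrier_mat n d \<times> Z)
     {GL_act n d Z g (j_map n d Z f) | g f. g \<in> carrier (GL d) \<and> f \<in> A}"

text \<open>The one-point variety \<open>{0} = k\<^sup>0\<close> with its only action, giving \<open>k[M\<^bsub>n,d\<^esub>]\<close>.\<close>

abbreviation point :: "'k :: field vec set" where
  "point \<equiv> {0\<^sub>v 0}"

abbreviation point_act :: "'k :: field mat \<Rightarrow> 'k vec \<Rightarrow> 'k vec" where
  "point_act \<equiv> (\<lambda>h. \<lambda>z\<in>point. z)"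

end

theory Submission
  imports Defs "Jordan_Normal_Form.Char_Poly"
begin

text \<open>
  Let \<open>F\<close> be an invariant and let \<open>p\<^bsub>\<sigma>\<^esub>(x)\<close> be the maximal minor of \<open>x\<close> on the distinct columns
  \<open>\<sigma>(1), \<dots>, \<sigma>(n)\<close>.  For a constant matrix \<open>u\<close>, the function
  \<open>F((x\<^bsub>\<sigma>(1)\<^esub>, \<dots>, x\<^bsub>\<sigma>(n)\<^esub>) u; z)\<close> lies in the algebra \<open>A = GL\<^sub>d * j(\<dots>)\<close>.  By Cramer's rule
  \<open>x = (x\<^bsub>\<sigma>(1)\<^esub>, \<dots>, x\<^bsub>\<sigma>(n)\<^esub>) T\<close> with entries of \<open>T\<close> of the form \<open>p\<^bsub>\<tau>\<^esub> / p\<^bsub>\<sigma>\<^esub>\<close>, so some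
  \<open>p\<^bsub>\<sigma>\<^esub>\<^sup>e F\<close> is a form of degree \<open>e\<close> in the minors with coefficients in \<open>A\<close>.  Hence \<open>F\<close> stabilises
  the \<open>A\<close>-module spanned by the monomials of large degree in the minors, and a
  characteristic polynomial gives the integral equation wherever \<open>x\<close> has rank \<open>n\<close>, which
  is a dense set.
\<close>

section \<open>Subalgebras of functions\<close>

text \<open>Restricting before testing membership lets the closure rules speak of plain lambda
  terms: values outside \<open>X\<close> do not matter.\<close>

definition alg_fun :: "'x set \<Rightarrow> ('x \<Rightarrow> 'k :: field) set \<Rightarrow> ('x \<Rightarrow> 'k) \<Rightarrow> bool" where
  "alg_fun X G f \<longleftrightarrow> restrict f X \<in> generated_algebra X G"

lemma generated_algebra_extensional:
  "f \<in> generated_algebra X G \<Longrightarrow> restrict f X = f"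
  by (induction rule: generated_algebra.induct) (auto simp: fun_eq_iff restrict_def)

lemma alg_fun_cong: "(\<And>x. x \<in> X \<Longrightarrow> f x = g x) \<Longrightarrow> alg_fun X G f \<longleftrightarrow> alg_fun X G g"
  unfolding alg_fun_def by (metis restrict_ext)

lemma alg_fun_generator: "f \<in> G \<Longrightarrow> alg_fun X G f"
  by (simp add: alg_fun_def generated_algebra.generator)

lemma alg_fun_const: "alg_fun X G (\<lambda>x. c)"
  by (simp add: alg_fun_def generated_algebra.const)

lemma alg_fun_add:
  assumes "alg_fun X G f" "alg_fun X G g"
  shows "alg_fun X G (\<lambda>x. f x + g x)"
proof -
  have "(\<lambda>x\<in>X. restrict f X x + restrict g X x) \<in> generated_algebra X G"
    using assms unfolding alg_fun_def by (rule generated_algebra.add)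
  also have "(\<lambda>x\<in>X. restrict f X x + restrict g X x) = (\<lambda>x\<in>X. f x + g x)"
    by auto
  finally show ?thesis unfolding alg_fun_def .
qed

lemma alg_fun_mult:
  assumes "alg_fun X G f" "alg_fun X G g"
  shows "alg_fun X G (\<lambda>x. f x * g x)"
proof -
  have "(\<lambda>x\<in>X. restrict f X x * restrict g X x) \<in> generated_algebra X G"
    using assms unfolding alg_fun_def by (rule generated_algebra.mult)
  also have "(\<lambda>x\<in>X. restrict f X x * restrict g X x) = (\<lambda>x\<in>X. f x * g x)"
    by auto
  finally show ?thesis unfolding alg_fun_def .
qed

lemma alg_fun_sum:
  "(\<And>i. i \<in> I \<Longrightarrow> alg_fun X G (f i)) \<Longrightarrow> alg_fun X G (\<lambda>x. \<Sum>i\<in>I. f i x)"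
  by (induction I rule: infinite_finite_induct) (auto intro: alg_fun_const alg_fun_add)

text \<open>Composition with \<psi> respects constants, sums and products, so only generators have
  to be checked. This serves for substitutions of matrices and, with \<psi> the identity, for
  comparing two generating sets.\<close>

lemma alg_fun_pullback:
  assumes f: "f \<in> generated_algebra Y G" and "\<psi> \<in> X \<rightarrow> Y"
    and "\<And>g. g \<in> G \<Longrightarrow> alg_fun X G' (g \<circ> \<psi>)"
  shows "alg_fun X G' (f \<circ> \<psi>)"
  using f
proof (induction rule: generated_algebra.induct)
  case (generator f)
  have "alg_fun X G' (f \<circ> \<psi>)" using generator assms(3) by blast
  thus ?case by (rule iffD1[OF alg_fun_cong, rotated]) (use assms(2) in auto)
next
  case (const c)
  have "alg_fun X G' (\<lambda>x. c)" by (rule alg_fun_const)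
  thus ?case by (rule iffD1[OF alg_fun_cong, rotated]) (use assms(2) in auto)
next
  case (add f g)
  have "alg_fun X G' (\<lambda>x. (f \<circ> \<psi>) x + (g \<circ> \<psi>) x)" using add alg_fun_add by blast
  thus ?case by (rule iffD1[OF alg_fun_cong, rotated]) (use assms(2) in auto)
next
  case (mult f g)
  have "alg_fun X G' (\<lambda>x. (f \<circ> \<psi>) x * (g \<circ> \<psi>) x)" using mult alg_fun_mult by blast
  thus ?case by (rule iffD1[OF alg_fun_cong, rotated]) (use assms(2) in auto)
qed

section \<open>Polynomials with coefficients in a subalgebra\<close>

lemma alg_fun_coeff_sum:
  "(\<And>i k. i \<in> I \<Longrightarrow> alg_fun X G (\<lambda>x. coeff (P i x) k)) \<Longrightarrow>
    alg_fun X G (\<lambda>x. coeff (\<Sum>i\<in>I. P i x) k)"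
  by (simp add: coeff_sum alg_fun_sum)

lemma alg_fun_coeff_mult:
  assumes "\<And>k. alg_fun X G (\<lambda>x. coeff (P x) k)" "\<And>k. alg_fun X G (\<lambda>x. coeff (Q x) k)"
  shows "alg_fun X G (\<lambda>x. coeff (P x * Q x) k)"
  unfolding coeff_mult by (intro alg_fun_sum alg_fun_mult assms)

lemma alg_fun_coeff_prod:
  "(\<And>i k. i \<in> I \<Longrightarrow> alg_fun X G (\<lambda>x. coeff (P i x) k)) \<Longrightarrow>
    alg_fun X G (\<lambda>x. coeff (\<Prod>i\<in>I. P i x) k)"
  by (induction I arbitrary: k rule: infinite_finite_induct)
    (auto intro: alg_fun_const alg_fun_coeff_mult)

text \<open>The Leibniz formula writes the characteristic polynomial as a sum of signed products of
  polynomials of degree at most one whose coefficients lie in the algebra; the signs are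
  constants.\<close>

lemma alg_fun_coeff_char_poly:
  fixes c :: "nat \<Rightarrow> nat \<Rightarrow> 'x \<Rightarrow> 'k :: field"
  assumes c: "\<And>i j. i < N \<Longrightarrow> j < N \<Longrightarrow> alg_fun X G (c i j)"
  shows "alg_fun X G (\<lambda>x. coeff (char_poly (mat N N (\<lambda>(i, j). c i j x))) k)"
proof -
  have eq: "char_poly (mat N N (\<lambda>(i, j). c i j x)) =
    (\<Sum>p\<in>{p. p permutes {0..<N}}. signof p *
      (\<Prod>i = 0..<N. [:- c i (p i) x, if i = p i then 1 else 0:]))" for x
  proof -
    have "char_poly (mat N N (\<lambda>(i, j). c i j x)) =
      (\<Sum>p\<in>{p. p permutes {0..<N}}. signof p *
        (\<Prod>i = 0..<N. char_poly_matrix (mat N N (\<lambda>(i, j). c i j x)) $$ (i, p i)))"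
      unfolding char_poly_def by (rule det_def') simp
    also have "\<dots> = (\<Sum>p\<in>{p. p permutes {0..<N}}. signof p *
      (\<Prod>i = 0..<N. [:- c i (p i) x, if i = p i then 1 else 0:]))"
    proof (intro sum.cong refl arg_cong2[where f = "(*)"] prod.cong)
      fix p i assume "p \<in> {p. p permutes {0..<N}}" and i: "i \<in> {0..<N}"
      hence "p i < N" using permutes_in_image[of p "{0..<N}" i] by auto
      thus "char_poly_matrix (mat N N (\<lambda>(i, j). c i j x)) $$ (i, p i) =
        [:- c i (p i) x, if i = p i then 1 else 0:]"
        using i by (auto simp: char_poly_matrix_def)
    qed
    finally show ?thesis .
  qed
  have neg: "alg_fun X G (\<lambda>x. - c i j x)" if "i < N" "j < N" for i j
    using alg_fun_mult[OF alg_fun_const c[OF that], of "-1"] by simp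
  have entry: "alg_fun X G (\<lambda>x. coeff [:- c i (p i) x, if i = p i then 1 else 0:] k)"
    if "p permutes {0..<N}" "i \<in> {0..<N}" for p i k
  proof -
    have "p i < N" using permutes_in_image[OF that(1), of i] that(2) by auto
    with that(2) have "alg_fun X G (\<lambda>x. - c i (p i) x)" by (intro neg) auto
    moreover have "coeff [:a, b:] k = (if k = 0 then a else if k = 1 then b else 0)"
      for a b :: 'k by (simp add: coeff_pCons split: nat.splits)
    ultimately show ?thesis by (cases "k = 0") (simp_all add: alg_fun_const)
  qed
  show ?thesis unfolding eq
  proof (rule alg_fun_coeff_sum, rule alg_fun_coeff_mult, rule alg_fun_const)
    fix p l assume "p \<in> {p. p permutes {0..<N}}"
    thus "alg_fun X G (\<lambda>x. coeff (\<Prod>i = 0..<N.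
      [:- c i (p i) x, if i = p i then 1 else 0:]) l)"
      by (intro alg_fun_coeff_prod entry) auto
  qed
qed

text \<open>
  If \<open>F\<close> maps a finitely generated module into itself, then at every point where some
  generator does not vanish, \<open>F\<close> is an eigenvalue of the matrix of that map.
\<close>

lemma integral_equation_of_stable_module:
  fixes F :: "'x \<Rightarrow> 'k :: field" and v :: "'i \<Rightarrow> 'x \<Rightarrow> 'k"
  assumes L: "finite L" "L \<noteq> {}"
    and a: "\<And>i j. i \<in> L \<Longrightarrow> j \<in> L \<Longrightarrow> alg_fun X G (a i j)"
    and F: "\<And>i x. i \<in> L \<Longrightarrow> x \<in> X \<Longrightarrow> F x * v i x = (\<Sum>j\<in>L. a i j x * v j x)"
  shows "\<exists>m>0. \<exists>c. (\<forall>i. alg_fun X G (c i)) \<and>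
    (\<forall>x\<in>X. (\<exists>i\<in>L. v i x \<noteq> 0) \<longrightarrow> F x ^ m + (\<Sum>i<m. c i x * F x ^ i) = 0)"
proof -
  define N where "N = card L"
  obtain e where e: "bij_betw e {0..<N} L"
    using ex_bij_betw_nat_finite[OF L(1)] unfolding N_def by blast
  have eL: "e i \<in> L" if "i < N" for i using e that by (auto simp: bij_betw_def)
  define C where "C x = mat N N (\<lambda>(i, j). a (e i) (e j) x)" for x
  have C: "C x \<in> carrier_mat N N" for x by (simp add: C_def)
  have N: "N > 0" using L by (simp add: N_def card_gt_0_iff)
  have "F x ^ N + (\<Sum>i<N. coeff (char_poly (C x)) i * F x ^ i) = 0"
    if x: "x \<in> X" and v: "\<exists>i\<in>L. v i x \<noteq> 0" for x
  proof -
    obtain i' where "i' \<in> L" and nz: "v i' x \<noteq> 0" using v by blast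
    then obtain k' where k': "k' < N" "e k' = i'" using e by (force simp: bij_betw_def)
    define w where "w = vec N (\<lambda>i. v (e i) x)"
    have "C x *\<^sub>v w = F x \<cdot>\<^sub>v w"
    proof (rule eq_vecI)
      fix i assume "i < dim_vec (F x \<cdot>\<^sub>v w)"
      hence i: "i < N" by (simp add: w_def)
      have "(C x *\<^sub>v w) $ i = (\<Sum>j = 0..<N. a (e i) (e j) x * v (e j) x)"
        using i by (simp add: C_def w_def scalar_prod_def)
      also have "\<dots> = (\<Sum>j\<in>L. a (e i) j x * v j x)"
        by (rule sum.reindex_bij_betw[OF e])
      also have "\<dots> = F x * v (e i) x" using F[OF eL[OF i] x] by simp
      finally show "(C x *\<^sub>v w) $ i = (F x \<cdot>\<^sub>v w) $ i" using i by (simp add: w_def)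
    qed (simp add: C_def w_def)
    moreover have "w \<noteq> 0\<^sub>v N"
    proof
      assume "w = 0\<^sub>v N"
      hence "w $ k' = 0" using k' by simp
      thus False using nz k' by (simp add: w_def)
    qed
    moreover have "w \<in> carrier_vec N" by (simp add: w_def)
    moreover have "dim_row (C x) = N" by (simp add: C_def)
    ultimately have "eigenvalue (C x) (F x)"
      unfolding eigenvalue_def eigenvector_def by (intro exI[of _ w]) simp
    hence "poly (char_poly (C x)) (F x) = 0"
      using eigenvalue_root_char_poly[OF C] by blast
    \<comment> \<open>The characteristic polynomial is monic of degree \<open>N\<close>, so its
      leading term contributes exactly \<open>F x ^ N\<close>.\<close>
    moreover have "poly (char_poly (C x)) (F x) =
      F x ^ N + (\<Sum>i<N. coeff (char_poly (C x)) i * F x ^ i)"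
      using degree_monic_char_poly[OF C, of x]
      by (simp add: poly_altdef lessThan_Suc_atMost[symmetric])
    ultimately show ?thesis by simp
  qed
  moreover have "alg_fun X G (\<lambda>x. coeff (char_poly (C x)) i)" for i
    unfolding C_def by (intro alg_fun_coeff_char_poly a eL)
  ultimately show ?thesis using N
    by (intro exI[of _ N] conjI exI[of _ "\<lambda>i x. coeff (char_poly (C x)) i"]) auto
qed

section \<open>Forms with coefficients in a subalgebra\<close>

text \<open>Homogeneous forms in the \<open>p i\<close>, taken as functions and not as formal
  polynomials. The \<open>p i\<close> may satisfy relations, so one function can have several
  degrees; the zero function has all of them.\<close>

inductive form ::
  "'x set \<Rightarrow> ('x \<Rightarrow> 'k :: field) set \<Rightarrow> ('i \<Rightarrow> 'x \<Rightarrow> 'k) \<Rightarrow> 'i set \<Rightarrow> nat \<Rightarrow> ('x \<Rightarrow> 'k) \<Rightarrow> bool"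
  for X G p I
  where
    coeff: "alg_fun X G a \<Longrightarrow> form X G p I 0 a"
  | zero: "form X G p I e (\<lambda>x. 0)"
  | var: "form X G p I e f \<Longrightarrow> i \<in> I \<Longrightarrow> form X G p I (Suc e) (\<lambda>x. f x * p i x)"
  | add: "form X G p I e f \<Longrightarrow> form X G p I e g \<Longrightarrow> form X G p I e (\<lambda>x. f x + g x)"
  | cong: "form X G p I e f \<Longrightarrow> (\<And>x. x \<in> X \<Longrightarrow> g x = f x) \<Longrightarrow> form X G p I e g"

lemma form_mult_coeff:
  "form X G p I e f \<Longrightarrow> alg_fun X G a \<Longrightarrow> form X G p I e (\<lambda>x. f x * a x)"
proof (induction rule: form.induct)
  case (coeff b)
  thus ?case by (intro form.coeff alg_fun_mult)
next
  case (zero e)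
  show ?case by (simp add: form.zero)
next
  case (var e f i)
  hence "form X G p I (Suc e) (\<lambda>x. f x * a x * p i x)" by (intro form.var) auto
  thus ?case by (rule form.cong) simp
next
  case (add e f g)
  hence "form X G p I e (\<lambda>x. f x * a x + g x * a x)" by (intro form.add) auto
  thus ?case by (rule form.cong) (simp add: algebra_simps)
next
  case (cong e f g)
  hence "form X G p I e (\<lambda>x. f x * a x)" by auto
  thus ?case by (rule form.cong) (simp add: cong)
qed

lemma form_mult:
  assumes f: "form X G p I e f" and g: "form X G p I e' g"
  shows "form X G p I (e + e') (\<lambda>x. f x * g x)"
  using g
proof (induction rule: form.induct)
  case (coeff b)
  thus ?case using form_mult_coeff[OF f] by simp
next
  case (zero e)
  show ?case by (simp add: form.zero)
next
  case (var e' g i)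
  hence "form X G p I (Suc (e + e')) (\<lambda>x. f x * g x * p i x)" by (intro form.var) auto
  hence "form X G p I (e + Suc e') (\<lambda>x. f x * g x * p i x)" by simp
  thus ?case by (rule form.cong) simp
next
  case (add e' g h)
  hence "form X G p I (e + e') (\<lambda>x. f x * g x + f x * h x)" by (intro form.add) auto
  thus ?case by (rule form.cong) (simp add: algebra_simps)
next
  case (cong e' g h)
  hence "form X G p I (e + e') (\<lambda>x. f x * g x)" by auto
  thus ?case by (rule form.cong) (simp add: cong)
qed

lemma form_scale: "form X G p I e f \<Longrightarrow> form X G p I e (\<lambda>x. c * f x)"
  using form_mult_coeff[OF _ alg_fun_const, of X G p I e f c] by (simp add: mult.commute)

lemma form_variable:
  assumes "i \<in> I" shows "form X G p I 1 (p i)"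
proof -
  have "form X G p I (Suc 0) (\<lambda>x. 1 * p i x)"
    by (intro form.var form.coeff alg_fun_const assms)
  thus ?thesis by simp
qed

lemma form_sum:
  "(\<And>j. j \<in> J \<Longrightarrow> form X G p I e (f j)) \<Longrightarrow> form X G p I e (\<lambda>x. \<Sum>j\<in>J. f j x)"
  by (induction J rule: infinite_finite_induct) (auto intro: form.zero form.add)

lemma form_prod:
  assumes "finite J" and "\<And>j. j \<in> J \<Longrightarrow> form X G p I (e j) (f j)"
  shows "form X G p I (\<Sum>j\<in>J. e j) (\<lambda>x. \<Prod>j\<in>J. f j x)"
  using assms
  by (induction J rule: finite_induct) (auto intro: form.coeff alg_fun_const form_mult)

lemma form_power: "form X G p I e f \<Longrightarrow> form X G p I (k * e) (\<lambda>x. f x ^ k)"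
  by (induction k) (auto intro: form.coeff alg_fun_const form_mult)

lemma form_monomial:
  "set xs \<subseteq> I \<Longrightarrow> form X G p I (length xs) (\<lambda>x. \<Prod>i\<leftarrow>xs. p i x)"
proof (induction xs)
  case Nil
  show ?case by (simp add: form.coeff alg_fun_const)
next
  case (Cons i xs)
  hence "form X G p I (Suc (length xs)) (\<lambda>x. (\<Prod>i\<leftarrow>xs. p i x) * p i x)"
    by (intro form.var) auto
  thus ?case by (simp add: mult.commute)
qed

text \<open>Monomials are indexed by words, so that multiplying by a variable prepends a letter.
  Different words may give the same monomial, which is harmless because only the existence of
  coefficients is claimed.\<close>

lemma form_expansion:
  assumes "finite I" and "form X G p I e f"
  shows "\<exists>a. (\<forall>xs. alg_fun X G (a xs)) \<and> (\<forall>x\<in>X. f x =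
    (\<Sum>xs | set xs \<subseteq> I \<and> length xs = e. a xs x * (\<Prod>i\<leftarrow>xs. p i x)))"
  using assms(2)
proof (induction rule: form.induct)
  case (coeff b)
  have "{xs. set xs \<subseteq> I \<and> length xs = 0} = {[]}" by auto
  with coeff show ?case by (intro exI[of _ "\<lambda>_. b"]) auto
next
  case (zero e)
  show ?case by (intro exI[of _ "\<lambda>_ _. 0"]) (auto intro: alg_fun_const)
next
  case (var e f i)
  let ?L = "\<lambda>e. {xs. set xs \<subseteq> I \<and> length xs = e}"
  from var.IH obtain a where a: "\<And>xs. alg_fun X G (a xs)"
    "\<And>x. x \<in> X \<Longrightarrow> f x = (\<Sum>xs\<in>?L e. a xs x * (\<Prod>i\<leftarrow>xs. p i x))" by blast
  \<comment> \<open>A word starting with \<open>i\<close> inherits the coefficient of its tail;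
    words with another first letter get zero.\<close>
  define b where "b xs = (if hd xs = i then a (tl xs) else (\<lambda>x. 0))" for xs
  have "f x * p i x = (\<Sum>xs\<in>?L (Suc e). b xs x * (\<Prod>i\<leftarrow>xs. p i x))" if x: "x \<in> X" for x
  proof -
    have fin: "finite (?L e)" for e by (rule finite_lists_length_eq[OF assms(1)])
    have inj: "inj_on ((#) i) (?L e)" by (auto simp: inj_on_def)
    have "(\<Sum>xs\<in>?L (Suc e). b xs x * (\<Prod>i\<leftarrow>xs. p i x)) =
      (\<Sum>xs\<in>(#) i ` ?L e. b xs x * (\<Prod>i\<leftarrow>xs. p i x))"
    proof (rule sum.mono_neutral_right)
      show "\<forall>xs\<in>?L (Suc e) - (#) i ` ?L e. b xs x * (\<Prod>i\<leftarrow>xs. p i x) = 0"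
      proof
        fix xs assume xs: "xs \<in> ?L (Suc e) - (#) i ` ?L e"
        then obtain j ys where "xs = j # ys" by (cases xs) auto
        moreover from this xs have "j \<noteq> i" by auto
        ultimately show "b xs x * (\<Prod>i\<leftarrow>xs. p i x) = 0" by (simp add: b_def)
      qed
    qed (use fin var.hyps in auto)
    also have "\<dots> = (\<Sum>xs\<in>?L e. a xs x * (p i x * (\<Prod>i\<leftarrow>xs. p i x)))"
      by (subst sum.reindex[OF inj]) (simp add: b_def)
    also have "\<dots> = f x * p i x"
      by (simp add: a(2)[OF x] sum_distrib_left mult_ac)
    finally show ?thesis by simp
  qed
  moreover have "alg_fun X G (b xs)" for xs
    by (auto simp: b_def intro: a alg_fun_const)
  ultimately show ?case by (intro exI[of _ b]) auto
next
  case (add e f g)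
  then obtain a b where "\<forall>xs. alg_fun X G (a xs)" "\<forall>xs. alg_fun X G (b xs)"
    "\<forall>x\<in>X. f x = (\<Sum>xs | set xs \<subseteq> I \<and> length xs = e. a xs x * (\<Prod>i\<leftarrow>xs. p i x))"
    "\<forall>x\<in>X. g x = (\<Sum>xs | set xs \<subseteq> I \<and> length xs = e. b xs x * (\<Prod>i\<leftarrow>xs. p i x))"
    by blast
  thus ?case
    by (intro exI[of _ "\<lambda>xs x. a xs x + b xs x"])
      (auto intro: alg_fun_add simp: distrib_right sum.distrib)
next
  case (cong e f g)
  thus ?case by auto
qed

text \<open>The length is the sum of the counts, which would be at most \<open>card I * e\<close> if
  every count were below \<open>e\<close>. The successor also covers \<open>e = 0\<close>, where it
  forces \<open>I\<close> to be nonempty.\<close>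

lemma list_pigeonhole:
  assumes "finite I" "set xs \<subseteq> I" "length xs = Suc (card I * e)"
  shows "\<exists>i\<in>I. e \<le> count_list xs i"
proof (rule ccontr)
  assume "\<not> ?thesis"
  hence "sum (count_list xs) I \<le> card I * e"
    by (intro sum_bounded_above[where K = e, simplified]) auto
  thus False using sum_count_set[OF assms(2,1)] assms(3) by simp
qed

lemma prod_list_split_count:
  fixes q :: "'i \<Rightarrow> 'k :: comm_monoid_mult"
  shows "(\<Prod>j\<leftarrow>xs. q j) = q i ^ count_list xs i * (\<Prod>j\<leftarrow>filter (\<lambda>j. j \<noteq> i) xs. q j)"
  by (induction xs) (auto simp: mult_ac)

lemma length_split_count:
  "length xs = count_list xs i + length (filter (\<lambda>j. j \<noteq> i) xs)"
  by (induction xs) auto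

text \<open>
  Every monomial of large degree in the \<open>p i\<close> contains some \<open>p i\<close> to a high power, so
  \<open>F\<close> stabilises the module spanned by all monomials of that degree.
\<close>

lemma integral_equation_of_forms:
  fixes F :: "'x \<Rightarrow> 'k :: field"
  assumes I: "finite I" "I \<noteq> {}"
    and F: "\<And>i. i \<in> I \<Longrightarrow> form X G p I e (\<lambda>x. p i x ^ e * F x)"
  shows "\<exists>m>0. \<exists>c. (\<forall>i. alg_fun X G (c i)) \<and>
    (\<forall>x\<in>X. (\<exists>i\<in>I. p i x \<noteq> 0) \<longrightarrow> F x ^ m + (\<Sum>i<m. c i x * F x ^ i) = 0)"
proof -
  define N where "N = Suc (card I * e)"
  define L where "L = {xs. set xs \<subseteq> I \<and> length xs = N}"
  have L: "finite L" unfolding L_def by (rule finite_lists_length_eq[OF I(1)])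
  have rep: "replicate N i \<in> L" if "i \<in> I" for i using that by (auto simp: L_def)
  have "form X G p I N (\<lambda>x. F x * (\<Prod>i\<leftarrow>xs. p i x))" if xs: "xs \<in> L" for xs
  proof -
    from xs obtain i where i: "i \<in> I" "e \<le> count_list xs i"
      using list_pigeonhole[OF I(1), of xs e] by (auto simp: L_def N_def)
    \<comment> \<open>The monomial is split into \<open>p i ^ e\<close>, which absorbs
      \<open>F\<close> by hypothesis, the remaining \<open>?k\<close> factors \<open>p i\<close>,
      and the other letters. The three degrees add up to \<open>N\<close> again.\<close>
    let ?k = "count_list xs i - e" and ?ys = "filter (\<lambda>j. j \<noteq> i) xs"
    have "form X G p I (e + ?k * 1 + length ?ys)
      (\<lambda>x. p i x ^ e * F x * p i x ^ ?k * (\<Prod>j\<leftarrow>?ys. p j x))"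
      using xs by (intro form_mult F form_power form_variable form_monomial i)
        (auto simp: L_def)
    moreover have "e + ?k * 1 + length ?ys = N"
      using i(2) xs length_split_count[of xs i] by (simp add: L_def)
    moreover have "p i x ^ e * F x * p i x ^ ?k * (\<Prod>j\<leftarrow>?ys. p j x) =
      F x * (\<Prod>i\<leftarrow>xs. p i x)" for x
    proof -
      have "p i x ^ e * p i x ^ ?k = p i x ^ count_list xs i"
        using i(2) by (simp flip: power_add)
      thus ?thesis by (subst prod_list_split_count[of _ xs i]) (simp add: mult_ac)
    qed
    ultimately show ?thesis by simp
  qed
  hence "\<forall>xs\<in>L. \<exists>a. (\<forall>ys. alg_fun X G (a ys)) \<and> (\<forall>x\<in>X. F x * (\<Prod>i\<leftarrow>xs. p i x) =
      (\<Sum>ys\<in>L. a ys x * (\<Prod>i\<leftarrow>ys. p i x)))"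
    using form_expansion[OF I(1)] unfolding L_def by blast
  then obtain a where a: "\<And>xs ys. xs \<in> L \<Longrightarrow> alg_fun X G (a xs ys)"
    "\<And>xs x. xs \<in> L \<Longrightarrow> x \<in> X \<Longrightarrow> F x * (\<Prod>i\<leftarrow>xs. p i x) =
      (\<Sum>ys\<in>L. a xs ys x * (\<Prod>i\<leftarrow>ys. p i x))"
    by metis
  have "L \<noteq> {}" using rep I(2) by auto
  from integral_equation_of_stable_module[OF L this, of X G a F "\<lambda>xs x. \<Prod>i\<leftarrow>xs. p i x", OF a]
  obtain m c where m: "m > 0" "\<forall>i. alg_fun X G (c i)"
    and eq: "\<forall>x\<in>X. (\<exists>xs\<in>L. (\<Prod>i\<leftarrow>xs. p i x) \<noteq> 0) \<longrightarrow>
      F x ^ m + (\<Sum>i<m. c i x * F x ^ i) = 0"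
    by auto
  \<comment> \<open>The pure power \<open>p i ^ N\<close> is one of the module generators and is
    nonzero wherever \<open>p i\<close> is.\<close>
  have "\<exists>xs\<in>L. (\<Prod>i\<leftarrow>xs. p i x) \<noteq> 0" if "i \<in> I" "p i x \<noteq> 0" for i x
    using that rep[OF that(1)]
    by (intro bexI[of _ "replicate N i"]) auto
  hence "\<forall>x\<in>X. (\<exists>i\<in>I. p i x \<noteq> 0) \<longrightarrow> F x ^ m + (\<Sum>i<m. c i x * F x ^ i) = 0"
    using eq by meson
  with m show ?thesis by (intro exI[of _ m] conjI exI[of _ c])
qed

section \<open>Interpolation\<close>

text \<open>Over a finite field, one plus the product of all \<open>t - a\<close> would be a
  nonconstant polynomial without roots.\<close>

lemma infinite_UNIV_alg_closed_field: "infinite (UNIV :: 'k :: alg_closed_field set)"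
proof
  assume fin: "finite (UNIV :: 'k set)"
  let ?q = "\<Prod>a\<in>(UNIV :: 'k set). [:- a, 1:]"
  have "degree ?q = card (UNIV :: 'k set)"
    by (subst degree_prod_eq_sum_degree) auto
  moreover have "card (UNIV :: 'k set) > 0" using fin by (simp add: card_gt_0_iff)
  ultimately have "degree (?q + 1) > 0" by (subst degree_add_eq_left) auto
  then obtain x where "poly (?q + 1) x = 0" using alg_closed_imp_poly_has_root by blast
  moreover have "poly ?q x = 0" using fin by (auto simp: poly_prod prod_zero_iff)
  ultimately show False by simp
qed

definition lagrange_basis :: "'k :: field set \<Rightarrow> 'k \<Rightarrow> 'k \<Rightarrow> 'k" where
  "lagrange_basis S u t = (\<Prod>w\<in>S - {u}. (t - w) / (u - w))"

text \<open>Both sides are polynomials in \<open>t\<close> of degree below \<open>card S\<close>,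
  and they agree on \<open>S\<close>.\<close>

lemma lagrange_interpolation:
  fixes P :: "'k :: field poly"
  assumes S: "finite S" and P: "degree P < card S"
  shows "poly P t = (\<Sum>u\<in>S. poly P u * lagrange_basis S u t)"
proof -
  define B where "B u = (\<Prod>w\<in>S - {u}. smult (1 / (u - w)) [:- w, 1:])" for u
  have B: "poly (B u) t = lagrange_basis S u t" for u t
    by (simp add: B_def lagrange_basis_def poly_prod diff_divide_distrib)
  define Q where "Q = (\<Sum>u\<in>S. smult (poly P u) (B u))"
  have Q: "poly Q t = (\<Sum>u\<in>S. poly P u * lagrange_basis S u t)" for t
    by (simp add: Q_def poly_sum B)
  have "degree (B u) \<le> card S - 1" if "u \<in> S" for u
  proof -
    have "degree (B u) \<le> (\<Sum>w\<in>S - {u}. degree (smult (1 / (u - w)) [:- w, 1:]))"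
      unfolding B_def using S by (intro degree_prod_sum_le[unfolded o_def]) auto
    also have "\<dots> \<le> (\<Sum>w\<in>S - {u}. 1)" by (intro sum_mono) auto
    finally show ?thesis using S that by simp
  qed
  hence "degree Q \<le> card S - 1"
    unfolding Q_def using S by (intro degree_sum_le) (auto intro: order_trans[OF degree_smult_le])
  hence "degree Q < card S" using P by linarith
  have "poly P s = poly Q s" if s: "s \<in> S" for s
  proof -
    have "poly Q s = (\<Sum>u\<in>S. if u = s then poly P s else 0)"
      unfolding Q
    proof (intro sum.cong refl)
      fix u assume "u \<in> S"
      show "poly P u * lagrange_basis S u s = (if u = s then poly P s else 0)"
        using S s by (cases "u = s") (auto simp: lagrange_basis_def prod_zero_iff)
    qed
    thus ?thesis using S s by simp
  qed
  from poly_eqI_degree[OF this P \<open>degree Q < card S\<close>] have "poly P t = poly Q t"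
    by (rule arg_cong)
  also note Q
  finally show ?thesis .
qed

text \<open>Interpolation in one coordinate at a time, by induction on \<open>J\<close>. It suffices
  that \<phi> is a polynomial of bounded degree along each coordinate direction; coordinates outside
  \<open>J\<close> stay fixed as parameters.\<close>

lemma lagrange_interpolation_multi:
  fixes \<phi> :: "('i \<Rightarrow> 'k :: field) \<Rightarrow> 'k"
  assumes S: "finite S" and J: "finite J"
    and \<phi>: "\<And>T j. j \<in> J \<Longrightarrow> \<exists>P. degree P < card S \<and> (\<forall>s. \<phi> (T(j := s)) = poly P s)"
  shows "\<phi> T = (\<Sum>u\<in>J \<rightarrow>\<^sub>E S. \<phi> (\<lambda>j. if j \<in> J then u j else T j) *
    (\<Prod>j\<in>J. lagrange_basis S (u j) (T j)))"
  using J \<phi>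
proof (induction J arbitrary: T rule: finite_induct)
  case empty
  show ?case by simp
next
  case (insert i J)
  let ?ov = "\<lambda>u j. if j \<in> J then u j else T j"
  let ?b = "\<lambda>u. \<Prod>j\<in>J. lagrange_basis S (u j) (T j)"
  \<comment> \<open>With the coordinates in \<open>J\<close> frozen at \<open>u\<close>, the new
    coordinate \<open>i\<close> is interpolated; since \<open>i\<close> is not in \<open>J\<close>,
    its value is still \<open>T i\<close>.\<close>
  have step: "\<phi> (?ov u) = (\<Sum>s\<in>S. \<phi> ((?ov u)(i := s)) * lagrange_basis S s (T i))" for u
  proof -
    obtain P where P: "degree P < card S" "\<And>s. \<phi> ((?ov u)(i := s)) = poly P s"
      using insert.prems[of i "?ov u"] by blast
    have "(?ov u)(i := T i) = ?ov u" using insert.hyps(2) by (intro fun_upd_idem) simp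
    hence "\<phi> (?ov u) = poly P (T i)" using P(2)[of "T i"] by (simp only:)
    also have "\<dots> = (\<Sum>s\<in>S. poly P s * lagrange_basis S s (T i))"
      by (rule lagrange_interpolation[OF S P(1)])
    finally show ?thesis by (simp only: P(2))
  qed
  have "\<phi> T = (\<Sum>u\<in>J \<rightarrow>\<^sub>E S. \<phi> (?ov u) * ?b u)"
    by (intro insert.IH) (use insert.prems in auto)
  also have "\<dots> = (\<Sum>u\<in>J \<rightarrow>\<^sub>E S. \<Sum>s\<in>S.
      \<phi> ((?ov u)(i := s)) * (lagrange_basis S s (T i) * ?b u))"
    by (simp only: step sum_distrib_right mult.assoc)
  also have "\<dots> = (\<Sum>s\<in>S. \<Sum>u\<in>J \<rightarrow>\<^sub>E S.
      \<phi> ((?ov u)(i := s)) * (lagrange_basis S s (T i) * ?b u))"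
    by (rule sum.swap)
  also have "\<dots> = (\<Sum>(s, u)\<in>S \<times> (J \<rightarrow>\<^sub>E S).
      \<phi> ((?ov u)(i := s)) * (lagrange_basis S s (T i) * ?b u))"
    by (rule sum.cartesian_product)
  also have "\<dots> = (\<Sum>(s, u)\<in>S \<times> (J \<rightarrow>\<^sub>E S).
      \<phi> (\<lambda>j. if j \<in> insert i J then (u(i := s)) j else T j) *
      (\<Prod>j\<in>insert i J. lagrange_basis S ((u(i := s)) j) (T j)))"
  proof (intro sum.cong refl, clarify)
    fix s u
    have "(?ov u)(i := s) = (\<lambda>j. if j \<in> insert i J then (u(i := s)) j else T j)"
      by (rule ext) simp
    moreover have "lagrange_basis S s (T i) * ?b u =
      (\<Prod>j\<in>insert i J. lagrange_basis S ((u(i := s)) j) (T j))"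
    proof -
      have "?b u = (\<Prod>j\<in>J. lagrange_basis S ((u(i := s)) j) (T j))"
        using insert.hyps(2) by (intro prod.cong) auto
      thus ?thesis using insert.hyps by simp
    qed
    ultimately show "\<phi> ((?ov u)(i := s)) * (lagrange_basis S s (T i) * ?b u) =
      \<phi> (\<lambda>j. if j \<in> insert i J then (u(i := s)) j else T j) *
      (\<Prod>j\<in>insert i J. lagrange_basis S ((u(i := s)) j) (T j))" by simp
  qed
  also have "\<dots> = (\<Sum>u\<in>insert i J \<rightarrow>\<^sub>E S. \<phi> (\<lambda>j. if j \<in> insert i J then u j else T j) *
    (\<Prod>j\<in>insert i J. lagrange_basis S (u j) (T j)))"
    \<comment> \<open>Functions on \<open>insert i J\<close> correspond to pairs of a value at
      \<open>i\<close> and a function on \<open>J\<close>.\<close>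
    unfolding PiE_insert_eq
    by (subst sum.reindex[OF inj_combinator[OF insert.hyps(2)]])
      (auto intro!: sum.cong simp: case_prod_unfold)
  finally show ?case .
qed

text \<open>The power of \<open>b\<close> supplies one factor for each of the
  \<open>card S - 1\<close> linear factors, which turns a polynomial in \<open>q / b\<close> into a
  form in \<open>q\<close> and \<open>b\<close>.\<close>

lemma lagrange_basis_homogenise:
  assumes "finite S" "u \<in> S" "b \<noteq> 0"
  shows "b ^ (card S - 1) * lagrange_basis S u (q / b) = (\<Prod>w\<in>S - {u}. (q - w * b) / (u - w))"
proof -
  have "b ^ (card S - 1) = (\<Prod>w\<in>S - {u}. b)" using assms by simp
  hence "b ^ (card S - 1) * lagrange_basis S u (q / b) =
    (\<Prod>w\<in>S - {u}. b * ((q / b - w) / (u - w)))"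
    unfolding lagrange_basis_def prod.distrib by (simp only:)
  also have "\<dots> = (\<Prod>w\<in>S - {u}. (q - w * b) / (u - w))"
    using assms(3) by (intro prod.cong) (auto simp: field_simps)
  finally show ?thesis .
qed

section \<open>Maximal minors\<close>

definition select_cols :: "nat \<Rightarrow> (nat \<Rightarrow> nat) \<Rightarrow> 'k :: field mat \<Rightarrow> 'k mat" where
  "select_cols n \<sigma> x = mat n n (\<lambda>(i, l). x $$ (i, \<sigma> l))"

text \<open>Columns may repeat and come in any order, so the minors for
  \<open>\<sigma>(l := k)\<close> that Cramer's rule produces belong to the same family. The vector
  \<open>z\<close> is carried along to have functions on the product.\<close>

definition minor :: "nat \<Rightarrow> (nat \<Rightarrow> nat) \<Rightarrow> 'k :: field mat \<times> 'k vec \<Rightarrow> 'k" where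
  "minor n \<sigma> = (\<lambda>(x, z). det (select_cols n \<sigma> x))"

lemma select_cols_carrier [simp]: "select_cols n \<sigma> x \<in> carrier_mat n n"
  by (simp add: select_cols_def)

lemma minor_not_inj:
  assumes "\<not> inj_on \<sigma> {..<n}"
  shows "minor n \<sigma> y = 0"
proof -
  from assms obtain l k where lk: "l < n" "k < n" "l \<noteq> k" "\<sigma> l = \<sigma> k"
    by (auto simp: inj_on_def)
  have "det (select_cols n \<sigma> (fst y)) = 0"
    by (rule det_identical_columns[OF select_cols_carrier lk(3,1,2)])
      (use lk in \<open>auto simp: select_cols_def\<close>)
  thus ?thesis by (simp add: minor_def case_prod_unfold)
qed

text \<open>Cramer's rule: replacing column \<open>l\<close> of the selected square matrix by column
  \<open>k\<close> of \<open>x\<close> amounts to selecting with \<open>\<sigma>(l := k)\<close>.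
  The factor is given by a function \<open>T\<close> of index pairs, so that single entries can be
  varied later.\<close>

lemma select_cols_factorisation:
  fixes x :: "'k :: field mat"
  assumes x: "x \<in> carrier_mat n d" and nz: "minor n \<sigma> (x, z) \<noteq> 0"
  shows "\<exists>T. x = select_cols n \<sigma> x * mat n d T \<and>
    (\<forall>l<n. \<forall>k<d. T (l, k) = minor n (\<sigma>(l := k)) (x, z) / minor n \<sigma> (x, z))"
proof -
  let ?C = "select_cols n \<sigma> x"
  have "?C \<in> Units (ring_mat TYPE('k) n ())"
    using nz by (intro det_non_zero_imp_unit) (auto simp: minor_def)
  then obtain B where B: "B \<in> carrier_mat n n" "?C * B = 1\<^sub>m n"
    by (auto simp: Units_def ring_mat_def)
  define M where "M = B * x"
  have M: "M \<in> carrier_mat n d" using B x by (simp add: M_def)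
  have CM: "?C * M = x"
  proof -
    have "?C * M = (?C * B) * x"
      unfolding M_def by (rule assoc_mult_mat[symmetric, OF select_cols_carrier B(1) x])
    thus ?thesis using B x by simp
  qed
  have "M $$ (l, k) = minor n (\<sigma>(l := k)) (x, z) / minor n \<sigma> (x, z)" if lk: "l < n" "k < d" for l k
  proof -
    have "?C *\<^sub>v col M k = col x k"
      using col_mult2[OF select_cols_carrier M lk(2), of \<sigma> x] CM by simp
    moreover have "replace_col ?C (col x k) l = select_cols n (\<sigma>(l := k)) x"
      using x lk by (intro eq_matI) (auto simp: replace_col_def select_cols_def)
    moreover have "col M k \<in> carrier_vec n" by (rule col_carrier_vec[OF lk(2) M])
    moreover have "col M k $ l = M $$ (l, k)" using M lk by simp
    ultimately have "det (select_cols n (\<sigma>(l := k)) x) = M $$ (l, k) * det ?C"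
      using cramer_lemma_mat[OF select_cols_carrier _ lk(1), of "col M k" \<sigma> x]
      by (simp only:)
    thus ?thesis using nz by (simp add: minor_def)
  qed
  moreover have "x = ?C * mat n d (\<lambda>lk. M $$ lk)"
  proof -
    have "mat n d (\<lambda>lk. M $$ lk) = M" using M by (intro eq_matI) auto
    thus ?thesis using CM by simp
  qed
  ultimately show ?thesis by blast
qed

text \<open>Extending \<sigma> to a permutation of all \<open>d\<close> columns gives a permutation
  matrix \<open>g\<close> that moves the selected columns to the front.\<close>

lemma select_cols_by_GL:
  fixes \<sigma> :: "nat \<Rightarrow> nat"
  assumes inj: "inj_on \<sigma> {..<n}" and range: "\<sigma> ` {..<n} \<subseteq> {..<d}"
  shows "\<exists>g \<in> carrier (GL d :: 'k :: field mat monoid). \<forall>x\<in>carrier_mat n d.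
    select_cols n (\<lambda>l. l) (x * g) = select_cols n \<sigma> x"
proof -
  have nd: "n \<le> d" using card_mono[OF _ range] card_image[OF inj] by simp
  have "card {n..<d} = card ({..<d} - \<sigma> ` {..<n})"
    using range card_image[OF inj] by (simp add: card_Diff_subset)
  \<comment> \<open>The columns left over by \<sigma> are distributed over the places from
    \<open>n\<close> on.\<close>
  then obtain b where b: "bij_betw b {n..<d} ({..<d} - \<sigma> ` {..<n})"
    using finite_same_card_bij[of "{n..<d}"] by blast
  define \<pi> where "\<pi> l = (if l < n then \<sigma> l else b l)" for l
  have b': "b l \<in> {..<d} - \<sigma> ` {..<n}" if "n \<le> l" "l < d" for l
    using bij_betwE[OF b] that by simp
  have \<pi>_range: "\<pi> l < d" if "l < d" for l
    using range b'[of l] that by (auto simp: \<pi>_def)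
  have b_inj: "b l = b k \<longleftrightarrow> l = k" if "n \<le> l" "l < d" "n \<le> k" "k < d" for l k
    using bij_betw_imp_inj_on[OF b] that by (simp add: inj_on_eq_iff)
  have sep: "\<sigma> l \<noteq> b k" if "l < n" "n \<le> k" "k < d" for l k
    using b'[OF that(2,3)] that(1) by (metis DiffE imageI lessThan_iff)
  have \<pi>_inj: "\<pi> l = \<pi> k \<longleftrightarrow> l = k" if lk: "l < d" "k < d" for l k
  proof (cases "l < n")
    case True
    show ?thesis
    proof (cases "k < n")
      case True
      with \<open>l < n\<close> inj show ?thesis by (simp add: \<pi>_def inj_on_eq_iff)
    next
      case False
      with \<open>l < n\<close> sep[of l k] lk show ?thesis by (auto simp: \<pi>_def)
    qed
  next
    case False
    show ?thesis
    proof (cases "k < n")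
      case True
      with \<open>\<not> l < n\<close> sep[of k l] lk show ?thesis by (auto simp: \<pi>_def)
    next
      case False
      with \<open>\<not> l < n\<close> b_inj lk show ?thesis by (simp add: \<pi>_def)
    qed
  qed
  define g :: "'k mat" where "g = mat d d (\<lambda>(i, j). if i = \<pi> j then 1 else 0)"
  have g: "g \<in> carrier_mat d d" by (simp add: g_def)
  have "transpose_mat g * g = 1\<^sub>m d"
  proof (rule eq_matI)
    fix i j assume "i < dim_row (1\<^sub>m d :: 'k mat)" "j < dim_col (1\<^sub>m d :: 'k mat)"
    hence ij: "i < d" "j < d" by auto
    have "(transpose_mat g * g) $$ (i, j) =
      (\<Sum>k = 0..<d. (if k = \<pi> i then 1 else 0) * (if k = \<pi> j then 1 else 0))"
      using ij by (simp add: g_def scalar_prod_def)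
    also have "\<dots> = (\<Sum>k = 0..<d. if k = \<pi> i then (if \<pi> i = \<pi> j then 1 else 0) else 0)"
      by (intro sum.cong) auto
    also have "\<dots> = (if i = j then 1 else 0)"
      using ij \<pi>_range[of i] \<pi>_inj[of i j] by simp
    finally show "(transpose_mat g * g) $$ (i, j) = 1\<^sub>m d $$ (i, j)" using ij by simp
  qed (use g in auto)
  hence "det (transpose_mat g) * det g = 1"
    using det_mult[of "transpose_mat g" d g] g by simp
  hence "g \<in> carrier (GL d)"
    unfolding units_of_carrier using g by (intro det_non_zero_imp_unit) auto
  moreover have "select_cols n (\<lambda>l. l) (x * g) = select_cols n \<sigma> x"
    if x: "x \<in> carrier_mat n d" for x
  proof (rule eq_matI)
    fix i l assume "i < dim_row (select_cols n \<sigma> x)" "l < dim_col (select_cols n \<sigma> x)"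
    hence il: "i < n" "l < n" by (auto simp: select_cols_def)
    have "(x * g) $$ (i, l) = (\<Sum>k = 0..<d. x $$ (i, k) * (if k = \<pi> l then 1 else 0))"
      using x il nd by (simp add: g_def scalar_prod_def)
    also have "\<dots> = (\<Sum>k = 0..<d. if k = \<pi> l then x $$ (i, \<pi> l) else 0)"
      by (intro sum.cong) auto
    also have "\<dots> = x $$ (i, \<sigma> l)" using \<pi>_range[of l] il nd by (simp add: \<pi>_def)
    finally show "select_cols n (\<lambda>l. l) (x * g) $$ (i, l) = select_cols n \<sigma> x $$ (i, l)"
      using il by (simp add: select_cols_def)
  qed (auto simp: select_cols_def)
  ultimately show ?thesis by blast
qed

text \<open>The bound \<open>D\<close> is uniform in the line and in \<open>z\<close>, so one set of
  interpolation nodes will do for all points. Generators have degree at most one on a line;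
  \<open>D + E\<close> bounds both sums and products.\<close>

lemma matrix_coordinate_ring_on_line:
  fixes F :: "'k :: field mat \<times> 'k vec \<Rightarrow> 'k"
  assumes "F \<in> matrix_coordinate_ring n d m Z"
  shows "\<exists>D. \<forall>x\<in>carrier_mat n d. \<forall>v\<in>carrier_mat n d. \<forall>z\<in>Z.
    \<exists>P. degree P \<le> D \<and> (\<forall>s. F (x + s \<cdot>\<^sub>m v, z) = poly P s)"
  using assms unfolding matrix_coordinate_ring_def
proof (induction rule: generated_algebra.induct)
  case (generator f)
  show ?case
  proof (intro exI[of _ "1 :: nat"] ballI)
    fix x v :: "'k mat" and z :: "'k vec"
    assume xv: "x \<in> carrier_mat n d" "v \<in> carrier_mat n d" and z: "z \<in> Z"
    from generator consider
        i j where "i < n" "j < d" "f = (\<lambda>(x, z). x $$ (i, j))"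
      | l where "f = (\<lambda>(x, z). z $ l)" by auto
    thus "\<exists>P. degree P \<le> 1 \<and>
      (\<forall>s. restrict f (carrier_mat n d \<times> Z) (x + s \<cdot>\<^sub>m v, z) = poly P s)"
    proof cases
      case 1
      thus ?thesis using xv z by (intro exI[of _ "[:x $$ (i, j), v $$ (i, j):]"]) auto
    next
      case 2
      thus ?thesis using xv z by (intro exI[of _ "[:z $ l:]"]) auto
    qed
  qed
next
  case (const c)
  show ?case by (intro exI[of _ "0 :: nat"] ballI exI[of _ "[:c:]"]) auto
next
  case (add f g)
  then obtain D E where
    D: "\<forall>x\<in>carrier_mat n d. \<forall>v\<in>carrier_mat n d. \<forall>z\<in>Z.
      \<exists>P. degree P \<le> D \<and> (\<forall>s. f (x + s \<cdot>\<^sub>m v, z) = poly P s)" and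
    E: "\<forall>x\<in>carrier_mat n d. \<forall>v\<in>carrier_mat n d. \<forall>z\<in>Z.
      \<exists>P. degree P \<le> E \<and> (\<forall>s. g (x + s \<cdot>\<^sub>m v, z) = poly P s)" by blast
  show ?case
  proof (intro exI[of _ "D + E"] ballI)
    fix x v :: "'k mat" and z :: "'k vec"
    assume xv: "x \<in> carrier_mat n d" "v \<in> carrier_mat n d" and z: "z \<in> Z"
    obtain P where P: "degree P \<le> D" "\<And>s. f (x + s \<cdot>\<^sub>m v, z) = poly P s"
      using D xv z by meson
    obtain Q where Q: "degree Q \<le> E" "\<And>s. g (x + s \<cdot>\<^sub>m v, z) = poly Q s"
      using E xv z by meson
    have "degree (P + Q) \<le> D + E"
      using P(1) Q(1) by (intro degree_add_le) linarith+
    moreover have "(x + s \<cdot>\<^sub>m v, z) \<in> carrier_mat n d \<times> Z" for s using xv z by simp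
    hence "(\<lambda>y\<in>carrier_mat n d \<times> Z. f y + g y) (x + s \<cdot>\<^sub>m v, z) = poly (P + Q) s"
      for s by (simp only: restrict_apply' P(2) Q(2) poly_add poly_mult)
    ultimately show "\<exists>P. degree P \<le> D + E \<and> (\<forall>s. (\<lambda>y\<in>carrier_mat n d \<times> Z. f y + g y)
      (x + s \<cdot>\<^sub>m v, z) = poly P s)" by blast
  qed
next
  case (mult f g)
  then obtain D E where
    D: "\<forall>x\<in>carrier_mat n d. \<forall>v\<in>carrier_mat n d. \<forall>z\<in>Z.
      \<exists>P. degree P \<le> D \<and> (\<forall>s. f (x + s \<cdot>\<^sub>m v, z) = poly P s)" and
    E: "\<forall>x\<in>carrier_mat n d. \<forall>v\<in>carrier_mat n d. \<forall>z\<in>Z.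
      \<exists>P. degree P \<le> E \<and> (\<forall>s. g (x + s \<cdot>\<^sub>m v, z) = poly P s)" by blast
  show ?case
  proof (intro exI[of _ "D + E"] ballI)
    fix x v :: "'k mat" and z :: "'k vec"
    assume xv: "x \<in> carrier_mat n d" "v \<in> carrier_mat n d" and z: "z \<in> Z"
    obtain P where P: "degree P \<le> D" "\<And>s. f (x + s \<cdot>\<^sub>m v, z) = poly P s"
      using D xv z by meson
    obtain Q where Q: "degree Q \<le> E" "\<And>s. g (x + s \<cdot>\<^sub>m v, z) = poly Q s"
      using E xv z by meson
    have "degree (P * Q) \<le> D + E"
      using P(1) Q(1) by (intro order_trans[OF degree_mult_le] add_mono)
    moreover have "(x + s \<cdot>\<^sub>m v, z) \<in> carrier_mat n d \<times> Z" for s using xv z by simp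
    hence "(\<lambda>y\<in>carrier_mat n d \<times> Z. f y * g y) (x + s \<cdot>\<^sub>m v, z) = poly (P * Q) s"
      for s by (simp only: restrict_apply' P(2) Q(2) poly_add poly_mult)
    ultimately show "\<exists>P. degree P \<le> D + E \<and> (\<forall>s. (\<lambda>y\<in>carrier_mat n d \<times> Z. f y * g y)
      (x + s \<cdot>\<^sub>m v, z) = poly P s)" by blast
  qed
qed

section \<open>Invariants\<close>

locale vector_invariants =
  fixes n d m :: nat and H :: "'k :: alg_closed_field mat set" and Z :: "'k vec set"
    and act :: "'k mat \<Rightarrow> 'k vec \<Rightarrow> 'k vec"
  assumes le: "n \<le> d" and H: "subgroup H (GL n)" and act: "\<And>h. h \<in> H \<Longrightarrow> act h \<in> Z \<rightarrow> Z"
begin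

abbreviation inverse_in_GL :: "'k mat \<Rightarrow> 'k mat" where
  "inverse_in_GL h \<equiv> inv\<^bsub>GL n\<^esub> h"

lemma inverse_carrier: "h \<in> H \<Longrightarrow> inverse_in_GL h \<in> carrier_mat n n"
  using subgroup.m_inv_closed[OF H] subgroup.subset[OF H]
  by (auto simp: units_of_def Units_def ring_mat_def)

lemma act_inverse: "h \<in> H \<Longrightarrow> z \<in> Z \<Longrightarrow> act (inverse_in_GL h) z \<in> Z"
  using act[OF subgroup.m_inv_closed[OF H]] by auto

text \<open>Members of the coordinate ring are \<open>undefined\<close> off their domain, so
  equality of functions reduces to equality of values there. The number \<open>c\<close> of columns
  is free, to allow both \<open>n\<close> and \<open>d\<close>.\<close>

lemma H_invariants_iff:
  "F \<in> H_invariants n c H m Z act \<longleftrightarrow> F \<in> matrix_coordinate_ring n c m Z \<and>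
    (\<forall>h\<in>H. \<forall>x\<in>carrier_mat n c. \<forall>z\<in>Z. F (inverse_in_GL h * x, act (inverse_in_GL h) z) = F (x, z))"
proof -
  have "H_act n c Z act h F = F \<longleftrightarrow>
    (\<forall>x\<in>carrier_mat n c. \<forall>z\<in>Z. F (inverse_in_GL h * x, act (inverse_in_GL h) z) = F (x, z))"
    if "F \<in> matrix_coordinate_ring n c m Z" for h
  proof -
    have F: "restrict F (carrier_mat n c \<times> Z) = F"
      using that generated_algebra_extensional unfolding matrix_coordinate_ring_def by blast
    have "H_act n c Z act h F = F \<longleftrightarrow> (\<forall>y\<in>carrier_mat n c \<times> Z. H_act n c Z act h F y = F y)"
    proof
      assume eq: "\<forall>y\<in>carrier_mat n c \<times> Z. H_act n c Z act h F y = F y"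
      show "H_act n c Z act h F = F"
      proof
        fix y
        show "H_act n c Z act h F y = F y"
        proof (cases "y \<in> carrier_mat n c \<times> Z")
          case True
          thus ?thesis using eq by blast
        next
          case False
          thus ?thesis using F[THEN fun_cong, of y]
            by (simp only: H_act_def restrict_apply if_False)
        qed
      qed
    qed simp
    thus ?thesis by (auto simp: H_act_def)
  qed
  thus ?thesis by (auto simp: H_invariants_def)
qed

section \<open>The generators of the subalgebra and their invariance\<close>

abbreviation generators :: "('k mat \<times> 'k vec \<Rightarrow> 'k) set" where
  "generators \<equiv> {GL_act n d Z g (j_map n d Z f) | g f.
    g \<in> carrier (GL d) \<and> f \<in> H_invariants n n H m Z act}"

abbreviation X :: "('k mat \<times> 'k vec) set" where
  "X \<equiv> carrier_mat n d \<times> Z"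

lemma GL_carrier: "g \<in> carrier (GL d) \<Longrightarrow> g \<in> carrier_mat d d"
  by (auto simp: units_of_def Units_def ring_mat_def)

lemma GL_act_j_map:
  assumes "g \<in> carrier (GL d)" "x \<in> carrier_mat n d" "z \<in> Z"
  shows "GL_act n d Z g (j_map n d Z f) (x, z) = f (select_cols n (\<lambda>l. l) (x * g), z)"
  using assms GL_carrier[OF assms(1)] by (simp add: GL_act_def j_map_def select_cols_def)

lemma alg_fun_entry:
  "i < n \<Longrightarrow> k < c \<Longrightarrow> alg_fun Y ({\<lambda>(x, z). x $$ (i, j) | i j. i < n \<and> j < c} \<union>
    {\<lambda>(x, z). z $ l | l. l < m}) (\<lambda>y. fst y $$ (i, k))"
  by (rule alg_fun_generator) (auto simp: fun_eq_iff)

text \<open>A generator is an invariant \<open>f\<close> composed with taking the first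
  \<open>n\<close> columns of \<open>x * g\<close>. This map is linear in \<open>x\<close> and
  commutes with left multiplication by elements of \<open>H\<close>.\<close>

lemma generator_invariant:
  assumes G: "G \<in> generators"
  shows "alg_fun X ({\<lambda>(x, z). x $$ (i, j) | i j. i < n \<and> j < d} \<union>
      {\<lambda>(x, z). z $ l | l. l < m}) G"
    and "\<And>h x z. h \<in> H \<Longrightarrow> x \<in> carrier_mat n d \<Longrightarrow> z \<in> Z \<Longrightarrow>
      G (inverse_in_GL h * x, act (inverse_in_GL h) z) = G (x, z)"
proof -
  let ?C = "\<lambda>c. {\<lambda>(x, z). x $$ (i, j) | i j. i < n \<and> j < c} \<union> {\<lambda>(x, z). z $ l | l. l < m} ::
    ('k mat \<times> 'k vec \<Rightarrow> 'k) set"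
  obtain g f where g: "g \<in> carrier (GL d)" and f: "f \<in> H_invariants n n H m Z act"
    and Gdef: "G = GL_act n d Z g (j_map n d Z f)" using G by blast
  have gc: "g \<in> carrier_mat d d" by (rule GL_carrier[OF g])
  let ?\<psi> = "\<lambda>(x, z). (select_cols n (\<lambda>l. l) (x * g), z)"
  have "alg_fun X (?C d) (f \<circ> ?\<psi>)"
  proof (rule alg_fun_pullback[of f "carrier_mat n n \<times> Z" "?C n"])
    show "f \<in> generated_algebra (carrier_mat n n \<times> Z) (?C n)"
      using f unfolding H_invariants_iff matrix_coordinate_ring_def by (rule conjunct1)
    show "?\<psi> \<in> X \<rightarrow> carrier_mat n n \<times> Z" by auto
    fix q assume "q \<in> ?C n"
    then consider i j where "i < n" "j < n" "q = (\<lambda>(x, z). x $$ (i, j))"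
      | l where "l < m" "q = (\<lambda>(x, z). z $ l)" by auto
    thus "alg_fun X (?C d) (q \<circ> ?\<psi>)"
    proof cases
      case 1
      have "alg_fun X (?C d) (\<lambda>y. \<Sum>k = 0..<d. fst y $$ (i, k) * g $$ (k, j))"
        using 1(1) by (intro alg_fun_sum alg_fun_mult alg_fun_const alg_fun_entry) auto
      thus ?thesis
        by (rule iffD1[OF alg_fun_cong, rotated])
          (use 1 gc le in \<open>auto simp: select_cols_def scalar_prod_def\<close>)
    next
      case 2
      have "q \<circ> ?\<psi> = q" using 2 by (auto simp: fun_eq_iff)
      moreover have "q \<in> ?C d" using 2 by blast
      ultimately show ?thesis by (simp only: alg_fun_generator)
    qed
  qed
  thus "alg_fun X (?C d) G"
    by (rule iffD1[OF alg_fun_cong, rotated]) (auto simp: Gdef GL_act_j_map[OF g])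
  fix h x :: "'k mat" and z :: "'k vec"
  assume h: "h \<in> H" and x: "x \<in> carrier_mat n d" and z: "z \<in> Z"
  let ?h = "inverse_in_GL h"
  have hc: "?h \<in> carrier_mat n n" by (rule inverse_carrier[OF h])
  have sel: "select_cols n (\<lambda>l. l) (?h * x * g) = ?h * select_cols n (\<lambda>l. l) (x * g)"
  proof -
    have "?h * x * g = ?h * (x * g)" by (rule assoc_mult_mat[OF hc x gc])
    moreover have "select_cols n (\<lambda>l. l) (?h * M) = ?h * select_cols n (\<lambda>l. l) M"
      if "M \<in> carrier_mat n d" for M
      using that hc le by (intro eq_matI) (auto simp: select_cols_def scalar_prod_def)
    moreover have "x * g \<in> carrier_mat n d" using x gc by simp
    ultimately show ?thesis by simp
  qed
  have "G (?h * x, act ?h z) = f (?h * select_cols n (\<lambda>l. l) (x * g), act ?h z)"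
    unfolding Gdef using hc x act_inverse[OF h z] by (subst GL_act_j_map[OF g]) (auto simp: sel)
  also have "\<dots> = f (select_cols n (\<lambda>l. l) (x * g), z)"
    using f h z unfolding H_invariants_iff by auto
  also have "\<dots> = G (x, z)" unfolding Gdef by (rule GL_act_j_map[OF g x z, symmetric])
  finally show "G (?h * x, act ?h z) = G (x, z)" .
qed

lemma GL_j_algebra_subset:
  "GL_j_algebra n d Z (H_invariants n n H m Z act) \<subseteq> H_invariants n d H m Z act"
proof
  fix f assume "f \<in> GL_j_algebra n d Z (H_invariants n n H m Z act)"
  hence f: "f \<in> generated_algebra X generators" by (simp add: GL_j_algebra_def)
  \<comment> \<open>Pulling back along the identity rewrites \<open>f\<close> in terms of the
    coordinate functions.\<close>
  have "f \<in> matrix_coordinate_ring n d m Z"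
    using alg_fun_pullback[OF f, of id X, simplified, OF generator_invariant(1)]
    unfolding alg_fun_def matrix_coordinate_ring_def generated_algebra_extensional[OF f] by auto
  moreover have "f (inverse_in_GL h * x, act (inverse_in_GL h) z) = f (x, z)"
    if h: "h \<in> H" and x: "x \<in> carrier_mat n d" and z: "z \<in> Z" for h x z
  proof -
    have in_X: "(inverse_in_GL h * x, act (inverse_in_GL h) z) \<in> X" "(x, z) \<in> X"
      using inverse_carrier[OF h] act_inverse[OF h z] x z by auto
    from f show ?thesis
    proof (induction rule: generated_algebra.induct)
      case (generator G)
      thus ?case using generator_invariant(2)[OF generator h x z] in_X by (simp only: restrict_apply')
    qed (use in_X in \<open>simp_all only: restrict_apply'\<close>)
  qed
  ultimately show "f \<in> H_invariants n d H m Z act" unfolding H_invariants_iff by blast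
qed

text \<open>Right multiplication by the constant matrix \<open>U\<close> commutes with
  \<open>H\<close>, so \<open>F (w * U, z)\<close> is an invariant of square matrices
  \<open>w\<close>. Applying \<open>j_map\<close> and a suitable permutation matrix then puts the
  columns chosen by \<sigma> in place of \<open>w\<close>.\<close>

lemma substituted_invariant:
  assumes F: "F \<in> H_invariants n d H m Z act" and U: "U \<in> carrier_mat n d"
    and inj: "inj_on \<sigma> {..<n}" and range: "\<sigma> ` {..<n} \<subseteq> {..<d}"
  shows "alg_fun X generators (\<lambda>(x, z). F (select_cols n \<sigma> x * U, z))"
proof -
  let ?C = "\<lambda>c. {\<lambda>(x, z). x $$ (i, j) | i j. i < n \<and> j < c} \<union> {\<lambda>(x, z). z $ l | l. l < m} ::
    ('k mat \<times> 'k vec \<Rightarrow> 'k) set"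
  let ?\<psi> = "\<lambda>(w, z). (w * U, z)"
  define f where "f = restrict (F \<circ> ?\<psi>) (carrier_mat n n \<times> Z)"
  have "alg_fun (carrier_mat n n \<times> Z) (?C n) (F \<circ> ?\<psi>)"
  proof (rule alg_fun_pullback[of F X "?C d"])
    show "F \<in> generated_algebra X (?C d)"
      using F unfolding H_invariants_iff matrix_coordinate_ring_def by (rule conjunct1)
    show "?\<psi> \<in> carrier_mat n n \<times> Z \<rightarrow> X" using U by auto
    fix q assume "q \<in> ?C d"
    then consider i j where "i < n" "j < d" "q = (\<lambda>(x, z). x $$ (i, j))"
      | l where "l < m" "q = (\<lambda>(x, z). z $ l)" by auto
    thus "alg_fun (carrier_mat n n \<times> Z) (?C n) (q \<circ> ?\<psi>)"
    proof cases
      case 1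
      have "alg_fun (carrier_mat n n \<times> Z) (?C n) (\<lambda>y. \<Sum>k = 0..<n. fst y $$ (i, k) * U $$ (k, j))"
        using 1(1) by (intro alg_fun_sum alg_fun_mult alg_fun_const alg_fun_entry) auto
      thus ?thesis
        by (rule iffD1[OF alg_fun_cong, rotated]) (use 1 U in \<open>auto simp: scalar_prod_def\<close>)
    next
      case 2
      have "q \<circ> ?\<psi> = q" using 2 by (auto simp: fun_eq_iff)
      moreover have "q \<in> ?C n" using 2 by blast
      ultimately show ?thesis by (simp only: alg_fun_generator)
    qed
  qed
  hence "f \<in> matrix_coordinate_ring n n m Z"
    by (simp only: f_def alg_fun_def matrix_coordinate_ring_def)
  moreover have "f (inverse_in_GL h * w, act (inverse_in_GL h) z) = f (w, z)"
    if h: "h \<in> H" and w: "w \<in> carrier_mat n n" and z: "z \<in> Z" for h w z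
  proof -
    let ?h = "inverse_in_GL h"
    have hc: "?h \<in> carrier_mat n n" by (rule inverse_carrier[OF h])
    have wU: "w * U \<in> carrier_mat n d" using w U by simp
    have "f (?h * w, act ?h z) = F (?h * w * U, act ?h z)"
      using hc w act_inverse[OF h z] by (simp add: f_def)
    also have "?h * w * U = ?h * (w * U)" by (rule assoc_mult_mat[OF hc w U])
    also have "F (?h * (w * U), act ?h z) = F (w * U, z)"
      using F h z wU unfolding H_invariants_iff by auto
    also have "\<dots> = f (w, z)" using w z by (simp add: f_def)
    finally show ?thesis .
  qed
  ultimately have f: "f \<in> H_invariants n n H m Z act" unfolding H_invariants_iff by blast
  obtain g where g: "g \<in> carrier (GL d :: 'k mat monoid)"
    and sel: "\<And>x. x \<in> carrier_mat n d \<Longrightarrow>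
      select_cols n (\<lambda>l. l) (x * g) = select_cols n \<sigma> x"
    using select_cols_by_GL[OF inj range] by blast
  have "alg_fun X generators (GL_act n d Z g (j_map n d Z f))"
    by (rule alg_fun_generator) (use f g in blast)
  thus ?thesis
    by (rule iffD1[OF alg_fun_cong, rotated]) (auto simp: GL_act_j_map[OF g] sel f_def)
qed

section \<open>Clearing denominators with powers of minors\<close>

abbreviation selections :: "(nat \<Rightarrow> nat) set" where
  "selections \<equiv> {..<n} \<rightarrow>\<^sub>E {..<d}"

text \<open>Varying one entry of the right factor moves the product along the line through
  \<open>A\<close> with direction \<open>V\<close>, so the bound for lines applies. For an index
  outside the matrix the direction is zero.\<close>

lemma update_columns_degree:
  fixes F :: "'k mat \<times> 'k vec \<Rightarrow> 'k"
  assumes D: "\<forall>x\<in>carrier_mat n d. \<forall>v\<in>carrier_mat n d. \<forall>z\<in>Z.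
      \<exists>P. degree P \<le> D \<and> (\<forall>s. F (x + s \<cdot>\<^sub>m v, z) = poly P s)"
    and C: "C \<in> carrier_mat n n" and z: "z \<in> Z"
  shows "\<exists>P. degree P \<le> D \<and> (\<forall>s. F (C * mat n d (T(j := s)), z) = poly P s)"
proof -
  define A where "A = C * mat n d (T(j := 0))"
  define V where "V = C * mat n d ((\<lambda>_. 0)(j := 1))"
  have "A \<in> carrier_mat n d" "V \<in> carrier_mat n d" using C by (auto simp: A_def V_def)
  with D z obtain P where P: "degree P \<le> D" "\<And>s. F (A + s \<cdot>\<^sub>m V, z) = poly P s" by meson
  have "C * mat n d (T(j := s)) = A + s \<cdot>\<^sub>m V" for s
  proof -
    have "mat n d (T(j := s)) = mat n d (T(j := 0)) + s \<cdot>\<^sub>m mat n d ((\<lambda>_. 0)(j := 1))"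
      by (intro eq_matI) auto
    hence "C * mat n d (T(j := s)) = C * mat n d (T(j := 0)) + C * (s \<cdot>\<^sub>m mat n d ((\<lambda>_. 0)(j := 1)))"
      using mult_add_distrib_mat[OF C, of "mat n d (T(j := 0))" d] by simp
    also have "C * (s \<cdot>\<^sub>m mat n d ((\<lambda>_. 0)(j := 1))) = s \<cdot>\<^sub>m V"
      unfolding V_def by (rule mult_smult_distrib[OF C mat_carrier])
    finally show ?thesis unfolding A_def .
  qed
  thus ?thesis using P by (intro exI[of _ P]) simp
qed

text \<open>
  Interpolating \<open>F (select_cols n \<sigma> x * T; z)\<close> at constant matrices \<open>T\<close> avoids extracting
  its coefficients as a polynomial in \<open>T\<close>.  The extra factor \<open>minor n \<sigma>\<close>, the leading 1 in
  \<open>e\<close>, makes the identity hold also where that minor vanishes.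
\<close>

lemma minor_power_times_invariant:
  assumes F: "F \<in> H_invariants n d H m Z act"
  shows "\<exists>e. \<forall>\<sigma>\<in>selections.
    form X generators (minor n) selections e (\<lambda>y. minor n \<sigma> y ^ e * F y)"
proof -
  have "F \<in> matrix_coordinate_ring n d m Z" using F unfolding H_invariants_iff by blast
  then obtain D where D: "\<forall>x\<in>carrier_mat n d. \<forall>v\<in>carrier_mat n d. \<forall>z\<in>Z.
    \<exists>P. degree P \<le> D \<and> (\<forall>s. F (x + s \<cdot>\<^sub>m v, z) = poly P s)"
    using matrix_coordinate_ring_on_line by blast
  \<comment> \<open>\<open>Suc D\<close> nodes determine a polynomial of degree at most
    \<open>D\<close>, and each basis factor then needs the power \<open>D\<close> of the minor to
    clear its denominator.\<close>
  obtain S :: "'k set" where S: "finite S" "card S = Suc D"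
    using infinite_arbitrarily_large[OF infinite_UNIV_alg_closed_field] by blast
  define J where "J = {..<n} \<times> {..<d}"
  have J: "finite J" by (simp add: J_def)
  \<comment> \<open>The \<open>0\<close> is the degree of the coefficient
    \<open>F (select_cols n \<sigma> x * mat n d u, z)\<close>, and each entry of \<open>T\<close>
    contributes \<open>D\<close>. The sum is left in the shape that \<open>form_mult\<close>
    produces.\<close>
  define e where "e = 1 + (0 + (\<Sum>j\<in>J. D))"
  have "form X generators (minor n) selections e (\<lambda>y. minor n \<sigma> y ^ e * F y)"
    if \<sigma>: "\<sigma> \<in> selections" for \<sigma>
  proof (cases "inj_on \<sigma> {..<n}")
    case False
    \<comment> \<open>A repeated column makes the minor zero, and so its power, since
      \<open>e\<close> is positive.\<close>
    have "form X generators (minor n) selections e (\<lambda>y. 0)" by (rule form.zero)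
    thus ?thesis by (rule form.cong) (simp add: minor_not_inj[OF False] e_def)
  next
    case True
    have range: "\<sigma> ` {..<n} \<subseteq> {..<d}" using \<sigma> by auto
    define q where "q = (\<lambda>(l, k). minor n (\<sigma>(l := k)) :: 'k mat \<times> 'k vec \<Rightarrow> 'k)"
    \<comment> \<open>This is the interpolation formula after clearing denominators, with
      \<open>q j\<close> the Cramer numerator of entry \<open>j\<close>. Differences and quotients
      are written as sums and scalar multiples, for which forms have closure rules.\<close>
    define R where "R y = minor n \<sigma> y * (\<Sum>u\<in>J \<rightarrow>\<^sub>E S.
      (\<lambda>(x, z). F (select_cols n \<sigma> x * mat n d u, z)) y *
      (\<Prod>j\<in>J. \<Prod>w\<in>S - {u j}. 1 / (u j - w) * (q j y + - w * minor n \<sigma> y)))" for y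
    have "form X generators (minor n) selections D
      (\<lambda>y. \<Prod>w\<in>S - {u j}. 1 / (u j - w) * (q j y + - w * minor n \<sigma> y))"
      if u: "u \<in> J \<rightarrow>\<^sub>E S" and j: "j \<in> J" for u j
    proof -
      obtain l k where lk: "j = (l, k)" "l < n" "k < d" using j by (auto simp: J_def)
      have "\<sigma>(l := k) \<in> selections" using \<sigma> lk by (auto simp: PiE_def extensional_def)
      hence "form X generators (minor n) selections (\<Sum>w\<in>S - {u j}. 1)
        (\<lambda>y. \<Prod>w\<in>S - {u j}. 1 / (u j - w) * (q j y + - w * minor n \<sigma> y))"
        unfolding q_def lk using S \<sigma>
        by (intro form_prod form_scale form.add form_variable)
          (auto intro: form_scale form_variable[unfolded One_nat_def])
      moreover have "u j \<in> S" using u j by auto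
      ultimately show ?thesis using S by simp
    qed
    hence "form X generators (minor n) selections e R"
      unfolding R_def e_def
      by (intro form_mult form_variable form_sum form_prod form.coeff substituted_invariant F True
          range J \<sigma>) auto
    thus ?thesis
    proof (rule form.cong)
      fix y assume "y \<in> X"
      then obtain x z where y: "y = (x, z)" and x: "x \<in> carrier_mat n d" and z: "z \<in> Z" by auto
      show "minor n \<sigma> y ^ e * F y = R y"
      proof (cases "minor n \<sigma> y = 0")
        case True
        thus ?thesis by (simp add: R_def e_def)
      next
        case False
        let ?C = "select_cols n \<sigma> x" and ?b = "minor n \<sigma> y"
        obtain T where T: "x = ?C * mat n d T"
          and Tq: "\<forall>l<n. \<forall>k<d. T (l, k) = minor n (\<sigma>(l := k)) y / ?b"
          using select_cols_factorisation[OF x, of \<sigma> z] False y by blast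
        have Tj: "T j = q j y / ?b" if "j \<in> J" for j
          using Tq that by (auto simp: q_def J_def)
        define \<phi> where "\<phi> T = F (?C * mat n d T, z)" for T
        have "\<exists>P. degree P < card S \<and> (\<forall>s. \<phi> (T(j := s)) = poly P s)" for T j
          using update_columns_degree[OF D select_cols_carrier z, of \<sigma> x T j] S(2)
          unfolding \<phi>_def by (simp add: less_Suc_eq_le)
        hence \<phi>_ov: "\<phi> T = (\<Sum>u\<in>J \<rightarrow>\<^sub>E S. \<phi> (\<lambda>j. if j \<in> J then u j else T j) *
          (\<Prod>j\<in>J. lagrange_basis S (u j) (T j)))"
          by (rule lagrange_interpolation_multi[OF S(1) J])
        \<comment> \<open>Only entries indexed by \<open>J\<close> are read by
          \<open>mat n d\<close>, so the node values are values of \<open>F\<close> at constant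
          matrices, independent of \<open>T\<close>.\<close>
        have ov: "\<phi> (\<lambda>j. if j \<in> J then u j else T j) = \<phi> u" for u
        proof -
          have "mat n d (\<lambda>j. if j \<in> J then u j else T j) = mat n d u"
            by (intro eq_matI) (auto simp: J_def)
          thus ?thesis by (simp only: \<phi>_def)
        qed
        have \<phi>T: "\<phi> T = (\<Sum>u\<in>J \<rightarrow>\<^sub>E S. \<phi> u * (\<Prod>j\<in>J. lagrange_basis S (u j) (T j)))"
          using \<phi>_ov unfolding ov .
        \<comment> \<open>Each entry \<open>j\<close> receives its own factor \<open>?b ^ D\<close>,
          which homogenises its basis factor.\<close>
        have clear: "?b ^ (\<Sum>j\<in>J. D) * (\<Prod>j\<in>J. lagrange_basis S (u j) (T j)) =
          (\<Prod>j\<in>J. \<Prod>w\<in>S - {u j}. 1 / (u j - w) * (q j y + - w * ?b))"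
          if u: "u \<in> J \<rightarrow>\<^sub>E S" for u
        proof -
          have "?b ^ (\<Sum>j\<in>J. D) * (\<Prod>j\<in>J. lagrange_basis S (u j) (T j)) =
            (\<Prod>j\<in>J. ?b ^ D * lagrange_basis S (u j) (T j))"
            by (simp only: power_sum prod.distrib)
          also have "\<dots> = (\<Prod>j\<in>J. \<Prod>w\<in>S - {u j}. 1 / (u j - w) * (q j y + - w * ?b))"
          proof (rule prod.cong[OF refl])
            fix j assume j: "j \<in> J"
            have "u j \<in> S" using u j by auto
            from lagrange_basis_homogenise[OF S(1) this False, of "q j y"] S(2)
            show "?b ^ D * lagrange_basis S (u j) (T j) =
              (\<Prod>w\<in>S - {u j}. 1 / (u j - w) * (q j y + - w * ?b))"
              by (simp add: Tj[OF j])
          qed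
          finally show ?thesis .
        qed
        have "F y = \<phi> T" using T y by (simp add: \<phi>_def)
        hence "?b ^ e * F y = ?b * (?b ^ (\<Sum>j\<in>J. D) * (\<Sum>u\<in>J \<rightarrow>\<^sub>E S. \<phi> u *
          (\<Prod>j\<in>J. lagrange_basis S (u j) (T j))))"
          by (simp only: \<phi>T e_def power_add power_one_right power_0 mult_1_left mult.assoc)
        also have "\<dots> = ?b * (\<Sum>u\<in>J \<rightarrow>\<^sub>E S. \<phi> u *
          (?b ^ (\<Sum>j\<in>J. D) * (\<Prod>j\<in>J. lagrange_basis S (u j) (T j))))"
          by (simp only: sum_distrib_left mult_ac)
        also have "\<dots> = ?b * (\<Sum>u\<in>J \<rightarrow>\<^sub>E S. \<phi> u *
          (\<Prod>j\<in>J. \<Prod>w\<in>S - {u j}. 1 / (u j - w) * (q j y + - w * ?b)))"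
          by (intro arg_cong2[where f = "(*)"] sum.cong refl clear)
        also have "\<dots> = R y" by (simp only: R_def y \<phi>_def prod.case)
        finally show ?thesis .
      qed
    qed
  qed
  thus ?thesis by blast
qed

text \<open>
  The integral equation is first obtained where some maximal minor of \<open>x\<close> is nonzero; it
  extends to all \<open>x\<close> along the lines \<open>x + s [I | 0]\<close>, on which the leading minor is a monic
  polynomial in \<open>s\<close>.
\<close>

lemma invariant_integral:
  assumes F: "F \<in> H_invariants n d H m Z act"
  shows "integral_element X (GL_j_algebra n d Z (H_invariants n n H m Z act)) F"
proof -
  obtain e where e: "\<forall>\<sigma>\<in>selections.
    form X generators (minor n) selections e (\<lambda>y. minor n \<sigma> y ^ e * F y)"
    using minor_power_times_invariant[OF F] by blast
  define \<iota> where "\<iota> = (\<lambda>l\<in>{..<n}. l)"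
  have \<iota>: "\<iota> \<in> selections" using le by (auto simp: \<iota>_def)
  \<comment> \<open>Selections are extensional functions, so there are only finitely many.\<close>
  have fin: "finite selections" by (intro finite_PiE) auto
  have "selections \<noteq> {}" using \<iota> by blast
  from integral_equation_of_forms[OF fin this, of X generators "minor n" e F] e
  obtain N c where N: "N > 0" and c: "\<forall>i. alg_fun X generators (c i)"
    and eq: "\<forall>y\<in>X. (\<exists>\<sigma>\<in>selections. minor n \<sigma> y \<noteq> 0) \<longrightarrow>
      F y ^ N + (\<Sum>i<N. c i y * F y ^ i) = 0" by auto
  define a where "a i = restrict (c i) X" for i
  have a: "a i \<in> GL_j_algebra n d Z (H_invariants n n H m Z act)" for i
    using c by (simp add: a_def alg_fun_def GL_j_algebra_def)
  have "F y ^ N + (\<Sum>i<N. a i y * F y ^ i) = 0" if y_X: "y \<in> X" for y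
  proof -
    obtain x z where y: "y = (x, z)" and x: "x \<in> carrier_mat n d" and z: "z \<in> Z"
      using y_X by auto
    define V :: "'k mat" where "V = mat n d (\<lambda>(i, j). if i = j then 1 else 0)"
    have V: "V \<in> carrier_mat n d" by (simp add: V_def)
    have on_line: "\<exists>P. \<forall>s. f (x + s \<cdot>\<^sub>m V, z) = poly P s"
      if "f \<in> H_invariants n d H m Z act" for f
    proof -
      have "f \<in> matrix_coordinate_ring n d m Z" using that unfolding H_invariants_iff by blast
      from matrix_coordinate_ring_on_line[OF this] x V z show ?thesis by meson
    qed
    obtain P where P: "\<And>s. F (x + s \<cdot>\<^sub>m V, z) = poly P s" using on_line[OF F] by blast
    \<comment> \<open>The coefficients lie in the subalgebra, hence are themselves invariants and
      polynomial on the line.\<close>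
    have "\<forall>i. \<exists>P. \<forall>s. a i (x + s \<cdot>\<^sub>m V, z) = poly P s"
      using on_line a GL_j_algebra_subset by blast
    then obtain Q where Q: "\<And>i s. a i (x + s \<cdot>\<^sub>m V, z) = poly (Q i) s" by metis
    define E where "E = P ^ N + (\<Sum>i<N. Q i * P ^ i)"
    have E: "poly E s = F (x + s \<cdot>\<^sub>m V, z) ^ N +
      (\<Sum>i<N. a i (x + s \<cdot>\<^sub>m V, z) * F (x + s \<cdot>\<^sub>m V, z) ^ i)" for s
      by (simp add: E_def poly_sum P Q)
    \<comment> \<open>The negative sign gives \<open>det (select_cols n \<iota> x + s I)\<close> at
      \<open>s\<close>, the leading minor on the line, as the value of a monic polynomial.\<close>
    define \<Delta> where "\<Delta> = char_poly (- select_cols n \<iota> x)"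
    have cc: "- select_cols n \<iota> x \<in> carrier_mat n n" by simp
    have \<Delta>: "poly \<Delta> s = minor n \<iota> (x + s \<cdot>\<^sub>m V, z)" for s
    proof -
      have "- char_matrix (- select_cols n \<iota> x) s = select_cols n \<iota> (x + s \<cdot>\<^sub>m V)"
        using x le by (intro eq_matI) (auto simp: char_matrix_def select_cols_def V_def \<iota>_def)
      thus ?thesis unfolding \<Delta>_def char_poly_matrix[OF cc] by (simp add: minor_def)
    qed
    \<comment> \<open>Where the leading minor is nonzero, the equation already obtained makes
      \<open>E\<close> vanish; elsewhere \<Delta> vanishes.\<close>
    have "poly (\<Delta> * E) s = 0" for s
    proof (cases "poly \<Delta> s = 0")
      case False
      have in_X: "(x + s \<cdot>\<^sub>m V, z) \<in> X" using x V z by simp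
      hence "F (x + s \<cdot>\<^sub>m V, z) ^ N +
        (\<Sum>i<N. c i (x + s \<cdot>\<^sub>m V, z) * F (x + s \<cdot>\<^sub>m V, z) ^ i) = 0"
        using eq \<iota> False unfolding \<Delta> by blast
      hence "poly E s = 0" unfolding E a_def by (simp only: restrict_apply'[OF in_X])
      thus ?thesis by simp
    qed simp
    hence "{s. poly (\<Delta> * E) s = 0} = UNIV" by blast
    \<comment> \<open>Infinitely many roots force the product to be zero; as \<Delta> is nonzero,
      \<open>E\<close> is zero, and \<open>s = 0\<close> recovers the point
      \<open>x\<close>.\<close>
    hence "\<Delta> * E = 0" using poly_roots_finite[of "\<Delta> * E"] infinite_UNIV_alg_closed_field by metis
    moreover have "\<Delta> \<noteq> 0"
      using degree_monic_char_poly[OF cc] unfolding \<Delta>_def by auto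
    ultimately have "poly E 0 = 0" by simp
    moreover have "x + 0 \<cdot>\<^sub>m V = x" using x V by (intro eq_matI) auto
    ultimately show ?thesis unfolding E y by simp
  qed
  thus ?thesis using N a unfolding integral_element_def by blast
qed

lemma invariants_integral:
  "integral_over X (H_invariants n d H m Z act)
    (GL_j_algebra n d Z (H_invariants n n H m Z act))"
  using GL_j_algebra_subset invariant_integral unfolding integral_over_def by blast

end

theorem theorem3:
  fixes H :: "'k :: alg_closed_field mat set"
    and Z :: "'k vec set"
    and act :: "'k mat \<Rightarrow> 'k vec \<Rightarrow> 'k vec"
    and n d m :: nat
  assumes "n \<le> d"
    and "subgroup H (GL n)"
    and "affine_variety m Z"
    and "acts_regularly n H m Z act"
  shows "integral_over (carrier_mat n d \<times> Z)
           (H_invariants n d H m Z act)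
           (GL_j_algebra n d Z (H_invariants n n H m Z act)) \<and>
         integral_over (carrier_mat n d \<times> point)
           (H_invariants n d H 0 point point_act)
           (GL_j_algebra n d point (H_invariants n n H 0 point point_act))"
proof
  interpret vector_invariants n d m H Z act
    using assms by (intro vector_invariants.intro) (auto simp: acts_regularly_def regular_map_def)
  show "integral_over (carrier_mat n d \<times> Z) (H_invariants n d H m Z act)
    (GL_j_algebra n d Z (H_invariants n n H m Z act))"
    by (rule invariants_integral)
next
  interpret point: vector_invariants n d 0 H point point_act
    using assms by (intro vector_invariants.intro) auto
  show "integral_over (carrier_mat n d \<times> point) (H_invariants n d H 0 point point_act)
    (GL_j_algebra n d point (H_invariants n n H 0 point point_act))"
    by (rule point.invariants_integral)
qed

end
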